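(* Let $p$ and $q$ be distinct odd primes. Then every group whose order is $pq$, $4p$ or $2pq$ is a t-group.
   Context: All groups are finite. Let $G$ be a finite group and $H\le G$. A normalized right transversal (NRT) of $H$ in $G$ is a subset $S\subseteq G$ containing exactly one element from each right coset of $H$ in $G$ and with $1\in S$. $\mathcal{T}(G,H)$ denotes the set of all NRTs of $H$ in $G$. Each NRT $S$ carries the binary operation $\circ$ defined by $\{x\circ y\}=S\cap Hxy$, which makes $S$ a right loop with identity $1$. Two NRTs (possibly of different subgroups) are isomorphic, written $S_1\cong S_2$, if there is a bijection between them preserving these operations. For a divisor $d$ of $|G|$, the transiso graph $\Gamma_d(G)$ is the simple graph whose vertices are the subgroups of $G$ of order $d$, two distinct vertices $H_1,H_2$ being adjacent if and only if there exist $S_1\in\mathcal{T}(G,H_1)$ and $S_2\in\mathcal{T}(G,H_2)$ with $S_1\cong S_2$. A graph is complete if any two distinct vertices are adjacent (so graphs with at most one vertex are complete). A finite group $G$ is a t-group if $\Gamma_d(G)$ is complete for every divisor $d$ of $|G|$. *)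

theory Defs
  imports "HOL-Algebra.Coset" "HOL-Computational_Algebra.Primes" "Graph_Theory.Kuratowski"
begin

definition NRTs :: "('a, 'b) monoid_scheme \<Rightarrow> 'a set \<Rightarrow> 'a set set" where
  "NRTs G H = {S. S \<subseteq> carrier G \<and> \<one>\<^bsub>G\<^esub> \<in> S \<and> (\<forall>C \<in> rcosets\<^bsub>G\<^esub> H. \<exists>!x. x \<in> S \<inter> C)}"

text \<open>The right loop carried by a transversal \<open>S\<close> is packaged as a \<open>monoid\<close> record so
  that the library's \<open>iso\<close> (operation-preserving bijections) applies to it; the record type by
  itself does not claim associativity.\<close>

definition NRT_loop :: "('a, 'b) monoid_scheme \<Rightarrow> 'a set \<Rightarrow> 'a set \<Rightarrow> 'a monoid" where
  "NRT_loop G H S =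
     \<lparr>carrier = S, monoid.mult = (\<lambda>x y. THE z. z \<in> S \<inter> (H #>\<^bsub>G\<^esub> (x \<otimes>\<^bsub>G\<^esub> y))), monoid.one = \<one>\<^bsub>G\<^esub>\<rparr>"

text \<open>Simple graphs are rendered, as in \<open>Graph_Theory\<close>, by symmetric loop-free digraphs:
  an edge is a pair of opposite arcs.\<close>

definition transiso_graph :: "nat \<Rightarrow> ('a, 'b) monoid_scheme \<Rightarrow> 'a set pair_pre_digraph" where
  "transiso_graph d G =
     (let V = {H. subgroup H G \<and> card H = d} in
      \<lparr>pverts = V,
       parcs = {(H1, H2). H1 \<in> V \<and> H2 \<in> V \<and> H1 \<noteq> H2 \<and>
          (\<exists>S1 \<in> NRTs G H1. \<exists>S2 \<in> NRTs G H2. NRT_loop G H1 S1 \<cong> NRT_loop G H2 S2)}\<rparr>)"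

definition t_group :: "('a, 'b) monoid_scheme \<Rightarrow> bool" where
  "t_group G \<longleftrightarrow> group G \<and> finite (carrier G) \<and>
     (\<forall>d. d dvd order G \<longrightarrow>
        complete_digraph (card (pverts (transiso_graph d G))) (with_proj (transiso_graph d G)))"

lemma NRT_mult_in:
  assumes "group G" "subgroup H G" "S \<in> NRTs G H" "x \<in> S" "y \<in> S"
  shows "x \<otimes>\<^bsub>NRT_loop G H S\<^esub> y \<in> S \<inter> (H #>\<^bsub>G\<^esub> (x \<otimes>\<^bsub>G\<^esub> y))"
proof -
  interpret group G by fact
  have "x \<otimes>\<^bsub>G\<^esub> y \<in> carrier G" using assms by (auto simp: NRTs_def)
  then have "H #>\<^bsub>G\<^esub> (x \<otimes>\<^bsub>G\<^esub> y) \<in> rcosets\<^bsub>G\<^esub> H" by (auto simp: RCOSETS_def)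
  then have "\<exists>!z. z \<in> S \<inter> (H #>\<^bsub>G\<^esub> (x \<otimes>\<^bsub>G\<^esub> y))" using assms(3) by (auto simp: NRTs_def)
  from theI'[OF this] show ?thesis by (simp add: NRT_loop_def)
qed

lemma NRT_loop_iso_sym:
  assumes "group G" "subgroup H1 G" "S1 \<in> NRTs G H1"
    and "NRT_loop G H1 S1 \<cong> NRT_loop G H2 S2"
  shows "NRT_loop G H2 S2 \<cong> NRT_loop G H1 S1"
proof -
  let ?A = "NRT_loop G H1 S1" and ?B = "NRT_loop G H2 S2"
  have c: "carrier ?A = S1" "carrier ?B = S2" by (auto simp: NRT_loop_def)
  obtain h where h: "h \<in> hom ?A ?B" "bij_betw h S1 S2"
    using assms(4) c by (auto simp: is_iso_def iso_def)
  let ?g = "inv_into S1 h"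
  have cl: "x \<otimes>\<^bsub>?A\<^esub> y \<in> S1" if "x \<in> S1" "y \<in> S1" for x y
    using NRT_mult_in[OF assms(1-3) that] by auto
  have g: "bij_betw ?g S2 S1" using h(2) by (rule bij_betw_inv_into)
  have "?g (u \<otimes>\<^bsub>?B\<^esub> v) = ?g u \<otimes>\<^bsub>?A\<^esub> ?g v" if "u \<in> S2" "v \<in> S2" for u v
  proof -
    have m: "?g u \<in> S1" "?g v \<in> S1" using g that by (auto dest: bij_betwE)
    have "h (?g u \<otimes>\<^bsub>?A\<^esub> ?g v) = h (?g u) \<otimes>\<^bsub>?B\<^esub> h (?g v)"
      using hom_mult[OF h(1)] m c by auto
    also have "\<dots> = u \<otimes>\<^bsub>?B\<^esub> v" using h(2) that by (simp add: bij_betw_inv_into_right)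
    finally show ?thesis
      using cl[OF m] h(2) by (metis bij_betw_inv_into_left)
  qed
  then have "?g \<in> hom ?B ?A" using g c by (auto simp: hom_def dest: bij_betwE)
  then show ?thesis using g c unfolding is_iso_def iso_def by auto
qed

lemma transiso_graph_is_graph:
  assumes "group G" "finite (carrier G)"
  shows "graph (with_proj (transiso_graph d G))"
proof -
  let ?T = "transiso_graph d G"
  have "pverts ?T \<subseteq> Pow (carrier G)"
    by (auto simp: transiso_graph_def Let_def dest: subgroup.subset)
  then have fv: "finite (pverts ?T)" using assms(2) by (meson finite_Pow_iff finite_subset)
  have sub: "parcs ?T \<subseteq> pverts ?T \<times> pverts ?T"
    by (auto simp: transiso_graph_def Let_def)
  have fa: "finite (parcs ?T)" using fv sub by (meson finite_SigmaI finite_subset)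
  have sy: "sym (parcs ?T)"
  proof (rule symI)
    fix H1 H2 assume a: "(H1, H2) \<in> parcs ?T"
    then obtain S1 S2 where "S1 \<in> NRTs G H1" "S2 \<in> NRTs G H2"
      and i: "NRT_loop G H1 S1 \<cong> NRT_loop G H2 S2"
      by (auto simp: transiso_graph_def Let_def)
    moreover have "NRT_loop G H2 S2 \<cong> NRT_loop G H1 S1"
      using NRT_loop_iso_sym[OF assms(1) _ _ i] a \<open>S1 \<in> NRTs G H1\<close>
      by (simp add: transiso_graph_def Let_def)
    ultimately show "(H2, H1) \<in> parcs ?T"
      using a unfolding transiso_graph_def Let_def by simp blast
  qed
  have nl: "(u, u) \<notin> parcs ?T" for u by (auto simp: transiso_graph_def Let_def)
  have ends: "arcs_ends (with_proj ?T) = parcs ?T"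
    by (auto simp: arcs_ends_def arc_to_ends_def)
  show ?thesis
    by unfold_locales
      (use fv fa sub sy nl ends in \<open>auto simp: symmetric_def arc_to_ends_def\<close>)
qed

lemma t_group_iff_adjacent:
  assumes "group G" "finite (carrier G)"
  shows "t_group G \<longleftrightarrow>
    (\<forall>d H1 H2. d dvd order G \<longrightarrow> subgroup H1 G \<longrightarrow> card H1 = d \<longrightarrow>
      subgroup H2 G \<longrightarrow> card H2 = d \<longrightarrow> H1 \<noteq> H2 \<longrightarrow>
      (\<exists>S1 \<in> NRTs G H1. \<exists>S2 \<in> NRTs G H2. NRT_loop G H1 S1 \<cong> NRT_loop G H2 S2))"
proof -
  have ends: "arcs_ends (with_proj T) = parcs T" for T :: "'a set pair_pre_digraph"
    by (auto simp: arcs_ends_def arc_to_ends_def)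
  have K: "complete_digraph (card (pverts (transiso_graph d G))) (with_proj (transiso_graph d G))
      \<longleftrightarrow> (\<forall>H1 H2. subgroup H1 G \<longrightarrow> card H1 = d \<longrightarrow> subgroup H2 G \<longrightarrow> card H2 = d \<longrightarrow> H1 \<noteq> H2 \<longrightarrow>
      (\<exists>S1 \<in> NRTs G H1. \<exists>S2 \<in> NRTs G H2. NRT_loop G H1 S1 \<cong> NRT_loop G H2 S2))"
    (is "_ \<longleftrightarrow> ?R") for d
  proof -
    have "complete_digraph (card (pverts (transiso_graph d G))) (with_proj (transiso_graph d G))
      \<longleftrightarrow> parcs (transiso_graph d G) = {(u, v). (u, v) \<in> pverts (transiso_graph d G) \<times>
            pverts (transiso_graph d G) \<and> u \<noteq> v}"
      unfolding complete_digraph_def ends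
      using transiso_graph_is_graph[OF assms, of d] by simp
    also have "\<dots> \<longleftrightarrow> ?R"
      unfolding transiso_graph_def Let_def set_eq_iff split_paired_All
      by (simp del: set_eq_iff) blast
    finally show ?thesis .
  qed
  show ?thesis using assms unfolding t_group_def K by blast
qed

end

theory Submission
  imports Defs "HOL-Algebra.Sylow" "HOL-Algebra.Group_Action" "HOL-Algebra.Multiplicative_Group"
begin

text \<open>
  Conjugation transports transversals together with their operations, so conjugate subgroups always
  have isomorphic NRTs; this settles the Sylow subgroups, and also the subgroups of order \<open>2p\<close> in a
  group of order \<open>2pq\<close>: after conjugation two of them share their Sylow \<open>p\<close>-subgroup \<open>P\<close>, which both
  normalize, and their involutions are conjugate in the normalizer of \<open>P\<close>. Two subgroups of index 2
  have a common transversal \<open>{1, x}\<close>.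

  The remaining case is order 2 in a group of order \<open>4p\<close>. Up to conjugation the two subgroups are
  \<open>{1, a}\<close> and \<open>{1, b}\<close> inside a Klein four-group \<open>T\<close>. Let \<open>P\<close> have order \<open>p\<close>. If some nontrivial
  element of \<open>T\<close> normalizes \<open>P\<close>, then \<open>P\<close> is normal and the subgroup \<open>P \<union> Pab\<close> is a common complement,
  which is an NRT of both with the same operation. Otherwise the conjugates of \<open>P\<close> by \<open>T\<close> cover
  \<open>4(p - 1)\<close> nontrivial elements, leaving exactly three others; these must be the \<open>p\<close> distinct
  conjugates of \<open>a\<close> by \<open>P\<close>, and likewise those of \<open>b\<close>, so that \<open>a\<close> and \<open>b\<close> are conjugate.
\<close>

section \<open>Conjugation and Sylow subgroups\<close>

text \<open>By orbit-stabilizer every orbit has \<open>p\<close>-power size. Without a fixed point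
  no orbit is a singleton, so \<open>p\<close> would divide the size of each orbit and hence
  \<open>card E\<close>.\<close>

lemma (in group_action) p_group_fixed_point:
  assumes "prime p" "order G = p ^ n" "finite E" "\<not> p dvd card E"
  shows "\<exists>x \<in> E. \<forall>g \<in> carrier G. \<phi> g x = x"
proof (rule ccontr)
  assume none: "\<not> ?thesis"
  have "p dvd card A" if A: "A \<in> orbits G E \<phi>" for A
  proof -
    obtain x where x: "x \<in> E" "A = orbit G \<phi> x"
      using A by (auto simp: orbits_def)
    have "card A dvd p ^ n"
      using orbit_stabilizer_theorem[OF x(1)] x(2) assms(2) by (metis dvd_triv_left)
    then obtain k where k: "card A = p ^ k"
      using assms(1) by (auto simp: divides_primepow_nat)
    obtain g where g: "g \<in> carrier G" "\<phi> g x \<noteq> x"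
      using none x(1) by blast
    have "\<phi> g x \<in> A" "x \<in> A"
      using g orbit_refl[OF x(1)] x(2) by (auto simp: orbit_def)
    then have "card A \<noteq> 1"
      using g(2) by (auto simp: card_1_singleton_iff)
    then show ?thesis using k by (cases k) auto
  qed
  moreover have "finite A" if "A \<in> orbits G E \<phi>" for A
    using that orbits_coverture assms(3) by (metis Union_upper finite_subset)
  moreover have "pairwise disjnt (orbits G E \<phi>)"
    using disjoint_union by (auto simp: pairwise_def disjnt_def)
  ultimately have "p dvd card (\<Union> (orbits G E \<phi>))"
    by (simp add: card_Union_disjoint dvd_sum)
  then show False using assms(4) orbits_coverture by simp
qed

context group
begin

text \<open>Right multiplication reverses products, and the inverse restores their order. The map is
  restricted to \<open>rcosets P\<close> because \<open>Bij\<close> asks for extensional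
  functions.\<close>

lemma action_on_rcosets:
  assumes "subgroup P G"
  shows "group_action G (rcosets P) (\<lambda>g. \<lambda>R \<in> rcosets P. R #> inv g)"
proof -
  have sub: "R \<subseteq> carrier G" if "R \<in> rcosets P" for R
    using that assms rcosets_subset_PowG by blast
  have cl: "R #> g \<in> rcosets P" if "R \<in> rcosets P" "g \<in> carrier G" for R g
    using that assms[THEN subgroup.subset] by (auto simp: RCOSETS_def coset_mult_assoc)
  have "bij_betw (\<lambda>R \<in> rcosets P. R #> inv g) (rcosets P) (rcosets P)" if g: "g \<in> carrier G" for g
    by (rule bij_betw_byWitness[where f' = "\<lambda>R. R #> g"])
      (use g cl sub in \<open>auto simp: coset_mult_assoc\<close>)
  then have Bij: "(\<lambda>R \<in> rcosets P. R #> inv g) \<in> Bij (rcosets P)" if "g \<in> carrier G" for g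
    using that by (simp add: Bij_def)
  have "(\<lambda>R \<in> rcosets P. R #> inv (g \<otimes> h))
      = compose (rcosets P) (\<lambda>R \<in> rcosets P. R #> inv g) (\<lambda>R \<in> rcosets P. R #> inv h)"
    if "g \<in> carrier G" "h \<in> carrier G" for g h
    unfolding compose_def
    by (rule restrict_ext) (use that cl sub in \<open>simp add: coset_mult_assoc inv_mult_group\<close>)
  with Bij have "(\<lambda>g. \<lambda>R \<in> rcosets P. R #> inv g) \<in> hom G (BijGroup (rcosets P))"
    by (auto simp: hom_def BijGroup_def)
  then show ?thesis
    by (simp add: group_action_def group_hom_def group_hom_axioms_def group_BijGroup)
qed

section \<open>Conjugation of elements and subgroups\<close>

definition conj_by :: "'a \<Rightarrow> 'a \<Rightarrow> 'a" where
  "conj_by g x = g \<otimes> x \<otimes> inv g"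

lemma conj_by_closed [simp]: "g \<in> carrier G \<Longrightarrow> x \<in> carrier G \<Longrightarrow> conj_by g x \<in> carrier G"
  by (simp add: conj_by_def)

lemma conj_by_one [simp]: "g \<in> carrier G \<Longrightarrow> conj_by g \<one> = \<one>"
  by (simp add: conj_by_def)

lemma conj_by_id [simp]: "x \<in> carrier G \<Longrightarrow> conj_by \<one> x = x"
  by (simp add: conj_by_def)

lemma conj_by_conj_by:
  "g \<in> carrier G \<Longrightarrow> h \<in> carrier G \<Longrightarrow> x \<in> carrier G \<Longrightarrow> conj_by g (conj_by h x) = conj_by (g \<otimes> h) x"
  by (simp add: conj_by_def inv_mult_group m_assoc)

lemma conj_by_mult:
  assumes "g \<in> carrier G" "x \<in> carrier G" "y \<in> carrier G"
  shows "conj_by g (x \<otimes> y) = conj_by g x \<otimes> conj_by g y"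
proof -
  have "inv g \<otimes> (g \<otimes> z) = z" if "z \<in> carrier G" for z
    using assms(1) that by (simp add: m_assoc[symmetric])
  then show ?thesis using assms by (simp add: conj_by_def m_assoc)
qed

lemma conj_by_inv:
  "g \<in> carrier G \<Longrightarrow> x \<in> carrier G \<Longrightarrow> conj_by g (inv x) = inv (conj_by g x)"
  by (simp add: conj_by_def inv_mult_group m_assoc)

lemma conj_by_inv_cancel [simp]:
  "g \<in> carrier G \<Longrightarrow> x \<in> carrier G \<Longrightarrow> conj_by (inv g) (conj_by g x) = x"
  "g \<in> carrier G \<Longrightarrow> x \<in> carrier G \<Longrightarrow> conj_by g (conj_by (inv g) x) = x"
  by (simp_all add: conj_by_conj_by)

lemma bij_betw_conj_by: "g \<in> carrier G \<Longrightarrow> bij_betw (conj_by g) (carrier G) (carrier G)"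
  by (rule bij_betw_byWitness[where f' = "conj_by (inv g)"]) auto

lemma conj_by_inj_iff [simp]:
  "g \<in> carrier G \<Longrightarrow> x \<in> carrier G \<Longrightarrow> y \<in> carrier G \<Longrightarrow> conj_by g x = conj_by g y \<longleftrightarrow> x = y"
  using bij_betw_conj_by by (metis bij_betw_imp_inj_on inj_on_eq_iff)

lemma image_conj_by_conj_by:
  assumes "g \<in> carrier G" "h \<in> carrier G" "H \<subseteq> carrier G"
  shows "conj_by g ` conj_by h ` H = conj_by (g \<otimes> h) ` H"
  unfolding image_image using assms by (intro image_cong) (auto simp: conj_by_conj_by)

lemma subgroup_conj_by:
  assumes "subgroup H G" "g \<in> carrier G"
  shows "subgroup (conj_by g ` H) G"
proof -
  interpret H: subgroup H G by fact
  show ?thesis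
  proof (rule subgroupI)
    show "conj_by g ` H \<noteq> {}" using H.one_closed by blast
  qed (use assms(2) in \<open>auto simp: conj_by_inv[symmetric] conj_by_mult[symmetric]\<close>)
qed

lemma card_conj_by:
  assumes "H \<subseteq> carrier G" "g \<in> carrier G"
  shows "card (conj_by g ` H) = card H"
  by (rule card_image) (use assms in \<open>auto simp: inj_on_def subset_iff\<close>)

lemma mem_image_conj_by_iff:
  assumes "H \<subseteq> carrier G" "g \<in> carrier G" "x \<in> carrier G"
  shows "conj_by g x \<in> conj_by g ` H \<longleftrightarrow> x \<in> H"
  using assms by (auto simp: subset_iff)

text \<open>The number \<open>m\<close> of cosets of \<open>P\<close> is prime to \<open>p\<close>,
  so the \<open>p\<close>-group \<open>K\<close>, acting on them, fixes some \<open>P #> g\<close>.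
  Being fixed says exactly that \<open>g\<close> conjugates \<open>K\<close> into
  \<open>P\<close>.\<close>

lemma sylow_conj:
  assumes "finite (carrier G)" "prime p" "order G = p ^ n * m" "\<not> p dvd m"
    and "subgroup P G" "card P = p ^ n" "subgroup K G" "card K = p ^ k"
  shows "\<exists>g \<in> carrier G. conj_by g ` K \<subseteq> P"
proof -
  let ?\<phi> = "\<lambda>g. \<lambda>R \<in> rcosets P. R #> inv g"
  interpret K: group_action "G\<lparr>carrier := K\<rparr>" "rcosets P" ?\<phi>
    using group_action.induced_action[OF action_on_rcosets] assms by blast
  have "card (rcosets P) * p ^ n = p ^ n * m"
    using lagrange_finite[OF assms(1,5)] assms(3,6) by simp
  then have "\<not> p dvd card (rcosets P)"
    using assms(2,4) by (simp add: prime_gt_0_nat)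
  moreover have "finite (rcosets P)"
    using assms(1,5) rcosets_subset_PowG by (meson finite_Pow_iff finite_subset)
  ultimately obtain R where R: "R \<in> rcosets P" "\<And>x. x \<in> K \<Longrightarrow> R #> inv x = R"
    using K.p_group_fixed_point[OF assms(2), of k] assms(8) by (auto simp: order_def)
  then obtain g where g: "g \<in> carrier G" "R = P #> g"
    by (auto simp: RCOSETS_def)
  interpret P: subgroup P G by fact
  have "conj_by g x \<in> P" if x: "x \<in> K" for x
  proof -
    have xc: "x \<in> carrier G" using x assms(7) by (meson subgroup.mem_carrier)
    have "P #> (g \<otimes> inv x) = P #> g"
      using R(2)[OF x] g xc P.subset by (simp add: coset_mult_assoc)
    then have "P #> (g \<otimes> inv x \<otimes> inv g) = P #> g #> inv g"
      using g xc P.subset by (metis coset_mult_assoc inv_closed m_closed)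
    also have "\<dots> = P"
      using g P.subset by (simp add: coset_mult_assoc)
    finally have "P #> (g \<otimes> inv x \<otimes> inv g) = P" .
    \<comment> \<open>Acting by \<open>x\<close> multiplies by \<open>inv x\<close>, so membership
      is obtained for the inverse first.\<close>
    then have "conj_by g (inv x) \<in> P"
      unfolding conj_by_def using coset_join1[OF _ _ P.subgroup_axioms] g xc by blast
    then show ?thesis
      using g xc by (metis P.m_inv_closed conj_by_closed conj_by_inv inv_inv)
  qed
  then show ?thesis using g by blast
qed

end

section \<open>Isomorphic transversals\<close>

text \<open>This is adjacency in the transiso graph without the condition that the two subgroups
  differ, which makes it reflexive on subgroups.\<close>

definition isomorphic_NRTs :: "('a, 'b) monoid_scheme \<Rightarrow> 'a set \<Rightarrow> 'a set \<Rightarrow> bool" where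
  "isomorphic_NRTs G H K \<longleftrightarrow>
    (\<exists>S \<in> NRTs G H. \<exists>T \<in> NRTs G K. NRT_loop G H S \<cong> NRT_loop G K T)"

context group
begin

section \<open>Transversals described by representatives\<close>

lemma mem_rcos_iff:
  "subgroup H G \<Longrightarrow> x \<in> carrier G \<Longrightarrow> g \<in> carrier G \<Longrightarrow> x \<in> H #> g \<longleftrightarrow> x \<otimes> inv g \<in> H"
  using subgroup.rcos_module[OF _ is_group] by blast

lemma NRTs_iff:
  assumes "subgroup H G"
  shows "S \<in> NRTs G H \<longleftrightarrow>
    S \<subseteq> carrier G \<and> \<one> \<in> S \<and> (\<forall>g \<in> carrier G. \<exists>!x. x \<in> S \<and> x \<otimes> inv g \<in> H)"
proof (cases "S \<subseteq> carrier G")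
  case True
  then have "x \<in> S \<inter> (H #> g) \<longleftrightarrow> x \<in> S \<and> x \<otimes> inv g \<in> H" if "g \<in> carrier G" for g x
    using that mem_rcos_iff[OF assms] by blast
  then show ?thesis
    by (simp add: NRTs_def RCOSETS_def del: Int_iff)
qed (simp add: NRTs_def)

lemma NRTs_subset: "S \<in> NRTs G H \<Longrightarrow> S \<subseteq> carrier G"
  by (simp add: NRTs_def)

lemma NRTs_ex1:
  "subgroup H G \<Longrightarrow> S \<in> NRTs G H \<Longrightarrow> g \<in> carrier G \<Longrightarrow> \<exists>!x. x \<in> S \<and> x \<otimes> inv g \<in> H"
  by (simp add: NRTs_iff)

lemma NRTs_unique:
  assumes "subgroup H G" "S \<in> NRTs G H" "g \<in> carrier G"
    and "x \<in> S" "x \<otimes> inv g \<in> H" "y \<in> S" "y \<otimes> inv g \<in> H"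
  shows "x = y"
  using NRTs_ex1[OF assms(1-3)] assms(4-) by (elim ex1E) metis

lemma NRT_mult:
  assumes "subgroup H G" "S \<in> NRTs G H" "x \<in> S" "y \<in> S"
  shows "x \<otimes>\<^bsub>NRT_loop G H S\<^esub> y \<in> S"
    and "(x \<otimes>\<^bsub>NRT_loop G H S\<^esub> y) \<otimes> inv (x \<otimes> y) \<in> H"
proof -
  let ?z = "x \<otimes>\<^bsub>NRT_loop G H S\<^esub> y"
  have z: "?z \<in> S \<inter> (H #> (x \<otimes> y))"
    by (rule NRT_mult_in[OF is_group assms])
  then show "?z \<in> S" by simp
  have "x \<in> carrier G" "y \<in> carrier G" "?z \<in> carrier G"
    using NRTs_subset[OF assms(2)] assms(3,4) z by auto
  with z show "?z \<otimes> inv (x \<otimes> y) \<in> H"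
    using mem_rcos_iff[OF assms(1), of ?z "x \<otimes> y"] by simp
qed

lemma NRT_mult_eq:
  assumes "subgroup H G" "S \<in> NRTs G H" "x \<in> S" "y \<in> S" "z \<in> S" "z \<otimes> inv (x \<otimes> y) \<in> H"
  shows "x \<otimes>\<^bsub>NRT_loop G H S\<^esub> y = z"
proof -
  have "x \<otimes> y \<in> carrier G" using NRTs_subset[OF assms(2)] assms(3,4) by auto
  then show ?thesis
    using NRTs_unique[OF assms(1,2)] NRT_mult[OF assms(1-4)] assms(5,6) by simp
qed

text \<open>The loop product of \<open>x\<close> and \<open>y\<close> is the only \<open>z\<close>
  in \<open>S\<close> with \<open>z \<otimes> inv (x \<otimes> y) \<in> H\<close>, so a bijection
  that carries this relation over is a homomorphism. The definite description need not be
  evaluated.\<close>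

lemma NRT_loop_isoI:
  assumes "subgroup H G" "subgroup K G" "S \<in> NRTs G H" "T \<in> NRTs G K" "bij_betw h S T"
    and "\<And>x y z. x \<in> S \<Longrightarrow> y \<in> S \<Longrightarrow> z \<in> S \<Longrightarrow> z \<otimes> inv (x \<otimes> y) \<in> H
      \<Longrightarrow> h z \<otimes> inv (h x \<otimes> h y) \<in> K"
  shows "NRT_loop G H S \<cong> NRT_loop G K T"
proof -
  let ?A = "NRT_loop G H S" and ?B = "NRT_loop G K T"
  have c: "carrier ?A = S" "carrier ?B = T" by (auto simp: NRT_loop_def)
  have hT: "h x \<in> T" if "x \<in> S" for x using assms(5) that by (auto dest: bij_betwE)
  have "h (x \<otimes>\<^bsub>?A\<^esub> y) = h x \<otimes>\<^bsub>?B\<^esub> h y" if "x \<in> S" "y \<in> S" for x y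
    using NRT_mult[OF assms(1,3) that] assms(6)[OF that] hT that
    by (intro NRT_mult_eq[OF assms(2,4), symmetric]) simp_all
  then have "h \<in> hom ?A ?B" using hT by (simp add: hom_def c Pi_iff)
  then show ?thesis using assms(5) c by (auto simp: is_iso_def iso_def)
qed

text \<open>Distinct elements of \<open>S\<close> lie in distinct cosets, and there are as many
  elements as cosets, so every coset is met.\<close>

lemma NRTs_finiteI:
  assumes "finite (carrier G)" "subgroup H G" "S \<subseteq> carrier G" "\<one> \<in> S"
    and "card S * card H = order G"
    and "\<And>x y. x \<in> S \<Longrightarrow> y \<in> S \<Longrightarrow> x \<otimes> inv y \<in> H \<Longrightarrow> x = y"
  shows "S \<in> NRTs G H"
proof -
  have H: "x \<in> H #> x" if "x \<in> carrier G" for x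
    using that assms(2) by (simp add: mem_rcos_iff subgroup.one_closed)
  have inj: "inj_on (\<lambda>x. H #> x) S"
  proof (rule inj_onI)
    fix x y assume xy: "x \<in> S" "y \<in> S" "H #> x = H #> y"
    then have "x \<in> H #> y" using H assms(3) by blast
    then have "x \<otimes> inv y \<in> H" using mem_rcos_iff[OF assms(2)] xy assms(3) by blast
    then show "x = y" using assms(6) xy by blast
  qed
  have sub: "(\<lambda>x. H #> x) ` S \<subseteq> rcosets H" using assms(3) by (auto simp: RCOSETS_def)
  have "card H > 0"
    using assms(1,5) order_gt_0_iff_finite by (metis bot_nat_0.not_eq_extremum mult_0_right)
  then have "card (rcosets H) = card S"
    using lagrange_finite[OF assms(1,2)] assms(5) by (metis mult_right_cancel not_gr_zero)
  moreover have "finite (rcosets H)"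
    using assms(1,2) rcosets_subset_PowG by (meson finite_Pow_iff finite_subset)
  ultimately have eq: "(\<lambda>x. H #> x) ` S = rcosets H"
    using sub inj by (metis card_image card_subset_eq)
  have "\<exists>!x. x \<in> S \<and> x \<otimes> inv g \<in> H" if g: "g \<in> carrier G" for g
  proof -
    have "H #> g \<in> (\<lambda>x. H #> x) ` S"
      unfolding eq using g by (auto simp: RCOSETS_def)
    then obtain x where x: "H #> g = H #> x" "x \<in> S" by (rule imageE)
    show ?thesis
    proof (rule ex1I[of _ x])
      have "x \<in> H #> g" unfolding x(1) using x(2) H assms(3) by blast
      then show "x \<in> S \<and> x \<otimes> inv g \<in> H"
        using x(2) mem_rcos_iff[OF assms(2) _ g] assms(3) by blast
      fix y assume y: "y \<in> S \<and> y \<otimes> inv g \<in> H"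
      then have "y \<in> H #> g"
        using mem_rcos_iff[OF assms(2) _ g] assms(3) by blast
      then have "H #> y = H #> x"
        using repr_independence[OF _ g assms(2)] x(1) by simp
      then show "y = x" using inj_on_eq_iff[OF inj, of y x] x(2) y by simp
    qed
  qed
  then show ?thesis using assms(3,4) by (simp add: NRTs_iff[OF assms(2)])
qed

section \<open>Common transversals and complements\<close>

lemma isomorphic_NRTs_common:
  assumes "subgroup H G" "subgroup K G" "S \<in> NRTs G H" "S \<in> NRTs G K"
    and "\<And>x y. x \<in> S \<Longrightarrow> y \<in> S \<Longrightarrow>
      \<exists>z \<in> S. z \<otimes> inv (x \<otimes> y) \<in> H \<and> z \<otimes> inv (x \<otimes> y) \<in> K"
  shows "isomorphic_NRTs G H K"
proof -
  have "z \<otimes> inv (x \<otimes> y) \<in> K"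
    if xyz: "x \<in> S" "y \<in> S" "z \<in> S" "z \<otimes> inv (x \<otimes> y) \<in> H" for x y z
  proof -
    obtain w where w: "w \<in> S" "w \<otimes> inv (x \<otimes> y) \<in> H" "w \<otimes> inv (x \<otimes> y) \<in> K"
      using assms(5)[OF xyz(1,2)] by blast
    have "x \<otimes> y \<in> carrier G" using NRTs_subset[OF assms(3)] xyz(1,2) by auto
    then have "z = w" using NRTs_unique[OF assms(1,3)] xyz(3,4) w(1,2) by simp
    then show ?thesis using w(3) by simp
  qed
  then have "NRT_loop G H S \<cong> NRT_loop G K S"
    using NRT_loop_isoI[OF assms(1-4), of id] by simp
  then show ?thesis using assms(3,4) by (auto simp: isomorphic_NRTs_def)
qed

text \<open>A complement that is a subgroup is closed under products, so its loop operation is the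
  group multiplication for \<open>H\<close> as well as for \<open>K\<close>.\<close>

lemma isomorphic_NRTs_complement:
  assumes "finite (carrier G)" "subgroup H G" "subgroup K G" "subgroup L G"
    and "L \<inter> H = {\<one>}" "L \<inter> K = {\<one>}" "card L * card H = order G" "card L * card K = order G"
  shows "isomorphic_NRTs G H K"
proof -
  interpret L: subgroup L G by fact
  have eq: "x = y" if "x \<in> L" "y \<in> L" "x \<otimes> inv y \<in> M" "L \<inter> M = {\<one>}" for x y M
  proof -
    have "x \<otimes> inv y \<in> L \<inter> M" using that(1-3) by simp
    then have "x \<otimes> inv y = \<one>" unfolding that(4) by simp
    then show ?thesis using that(1,2) inv_equality[of x "inv y"] by simp
  qed
  have "L \<in> NRTs G H" "L \<in> NRTs G K"
    using assms L.subset L.one_closed eq by (auto intro!: NRTs_finiteI)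
  moreover have "\<exists>z \<in> L. z \<otimes> inv (x \<otimes> y) \<in> H \<and> z \<otimes> inv (x \<otimes> y) \<in> K"
    if "x \<in> L" "y \<in> L" for x y
    using that assms(2,3) by (intro bexI[of _ "x \<otimes> y"]) (auto simp: subgroup.one_closed)
  ultimately show ?thesis by (rule isomorphic_NRTs_common[OF assms(2,3)])
qed

lemma isomorphic_NRTs_sym:
  "subgroup H G \<Longrightarrow> isomorphic_NRTs G H K \<Longrightarrow> isomorphic_NRTs G K H"
  unfolding isomorphic_NRTs_def using NRT_loop_iso_sym[OF is_group] by blast

lemma NRTs_nonempty:
  assumes "subgroup H G"
  shows "NRTs G H \<noteq> {}"
proof -
  \<comment> \<open>The representative of the coset that contains \<open>\<one>\<close> is forced to
    be \<open>\<one>\<close>, so that the transversal is normalized.\<close>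
  define f where "f C = (if \<one> \<in> C then \<one> else (SOME x. x \<in> C))" for C
  have f: "f C \<in> C" if "C \<in> rcosets H" for C
  proof -
    have "C \<noteq> {}" using that assms subgroup.rcosets_non_empty by blast
    then show ?thesis by (simp add: f_def some_in_eq)
  qed
  have disj: "C = D" if "C \<in> rcosets H" "D \<in> rcosets H" "x \<in> C" "x \<in> D" for C D x
    using that rcos_disjoint[OF assms] by (auto simp: pairwise_def disjnt_def)
  have "f ` (rcosets H) \<subseteq> carrier G"
    using f rcosets_part_G[OF assms] by blast
  moreover have "\<one> \<in> f ` (rcosets H)"
  proof (rule image_eqI)
    show "\<one> = f H" using assms by (simp add: f_def subgroup.one_closed)
    show "H \<in> rcosets H" using assms by (rule subgroup.subgroup_in_rcosets[OF _ is_group])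
  qed
  moreover have "\<exists>!x. x \<in> f ` (rcosets H) \<inter> C" if C: "C \<in> rcosets H" for C
  proof (rule ex1I[of _ "f C"])
    show "f C \<in> f ` (rcosets H) \<inter> C" using C f[OF C] by blast
    fix x assume "x \<in> f ` (rcosets H) \<inter> C"
    then obtain D where D: "D \<in> rcosets H" "x = f D" "x \<in> C" by blast
    then show "x = f C" using disj[OF C D(1) D(3)] f[OF D(1)] by simp
  qed
  ultimately have "f ` (rcosets H) \<in> NRTs G H" by (simp add: NRTs_def)
  then show ?thesis by blast
qed

lemma isomorphic_NRTs_refl: "subgroup H G \<Longrightarrow> isomorphic_NRTs G H H"
  unfolding isomorphic_NRTs_def using NRTs_nonempty by (metis all_not_in_conv iso_refl)

section \<open>Transport of transversals by conjugation\<close>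

lemma NRTs_conj_by:
  assumes "subgroup H G" "S \<in> NRTs G H" "g \<in> carrier G"
  shows "conj_by g ` S \<in> NRTs G (conj_by g ` H)"
proof -
  have S: "S \<subseteq> carrier G" "\<one> \<in> S"
    using assms(2) by (simp_all add: NRTs_def)
  have H: "H \<subseteq> carrier G" using assms(1) by (rule subgroup.subset)
  have "\<exists>!s. s \<in> conj_by g ` S \<and> s \<otimes> inv x \<in> conj_by g ` H" if x: "x \<in> carrier G" for x
  proof -
    define y where "y = conj_by (inv g) x"
    have y: "y \<in> carrier G" "x = conj_by g y"
      using x assms(3) by (simp_all add: y_def)
    have *: "conj_by g s \<otimes> inv x \<in> conj_by g ` H \<longleftrightarrow> s \<otimes> inv y \<in> H" if "s \<in> S" for s
    proof -
      have "s \<in> carrier G" using that S(1) by blast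
      then have "conj_by g s \<otimes> inv x = conj_by g (s \<otimes> inv y)"
        using y assms(3) by (simp add: conj_by_mult conj_by_inv)
      then show ?thesis using \<open>s \<in> carrier G\<close> y(1) H assms(3) by (simp add: mem_image_conj_by_iff)
    qed
    obtain s where s: "s \<in> S" "s \<otimes> inv y \<in> H"
      using NRTs_ex1[OF assms(1,2) y(1)] by (elim ex1E conjE) (rule that)
    show ?thesis
    proof (rule ex1I[of _ "conj_by g s"])
      show "conj_by g s \<in> conj_by g ` S \<and> conj_by g s \<otimes> inv x \<in> conj_by g ` H"
        using s * by simp
      fix u assume u: "u \<in> conj_by g ` S \<and> u \<otimes> inv x \<in> conj_by g ` H"
      then obtain t where t: "t \<in> S" "u = conj_by g t" by (elim conjE imageE) (rule that)
      then have "t \<otimes> inv y \<in> H" using u * by simp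
      then show "u = conj_by g s"
        using NRTs_unique[OF assms(1,2) y(1) t(1) _ s] t(2) by simp
    qed
  qed
  then show ?thesis
    using S assms(3) imageI[OF S(2), of "conj_by g"]
    by (auto simp: NRTs_iff[OF subgroup_conj_by[OF assms(1,3)]])
qed

text \<open>Conjugation is an automorphism that maps cosets of \<open>H\<close> to cosets of its
  conjugate, so it respects the loop operations. The conjugate stands on the left in order to chain
  with a given isomorphism through \<open>iso_trans\<close>.\<close>

lemma NRT_loop_conj_by:
  assumes "subgroup H G" "S \<in> NRTs G H" "g \<in> carrier G"
  shows "NRT_loop G (conj_by g ` H) (conj_by g ` S) \<cong> NRT_loop G H S"
proof -
  have S: "S \<subseteq> carrier G" using assms(2) by (rule NRTs_subset)
  have "NRT_loop G H S \<cong> NRT_loop G (conj_by g ` H) (conj_by g ` S)"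
  proof (rule NRT_loop_isoI[OF assms(1) subgroup_conj_by[OF assms(1,3)] assms(2) NRTs_conj_by[OF assms]])
    show "bij_betw (conj_by g) S (conj_by g ` S)"
      using S bij_betw_conj_by[OF assms(3)] bij_betw_subset by blast
    show "conj_by g z \<otimes> inv (conj_by g x \<otimes> conj_by g y) \<in> conj_by g ` H"
      if "x \<in> S" "y \<in> S" "z \<in> S" "z \<otimes> inv (x \<otimes> y) \<in> H" for x y z
    proof -
      have "x \<in> carrier G" "y \<in> carrier G" "z \<in> carrier G" using that S by auto
      then have "conj_by g z \<otimes> inv (conj_by g x \<otimes> conj_by g y) = conj_by g (z \<otimes> inv (x \<otimes> y))"
        using assms(3) by (simp add: conj_by_mult[symmetric] conj_by_inv[symmetric])
      then show ?thesis using that(4) by blast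
    qed
  qed
  then show ?thesis by (rule NRT_loop_iso_sym[OF is_group assms(1,2)])
qed

lemma isomorphic_NRTs_conj_by:
  assumes "subgroup H G" "g \<in> carrier G" "isomorphic_NRTs G H K"
  shows "isomorphic_NRTs G (conj_by g ` H) K"
  using assms NRTs_conj_by NRT_loop_conj_by iso_trans unfolding isomorphic_NRTs_def by blast

text \<open>This allows each subgroup to be moved by a conjugation of its own before the two are
  compared.\<close>

lemma isomorphic_NRTs_conj_by_cancel:
  assumes "subgroup H G" "subgroup K G" "g \<in> carrier G" "h \<in> carrier G"
    and "isomorphic_NRTs G (conj_by g ` H) (conj_by h ` K)"
  shows "isomorphic_NRTs G H K"
proof -
  have cancel: "conj_by (inv x) ` conj_by x ` A = A" if "x \<in> carrier G" "A \<subseteq> carrier G" for x A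
    using that by (force simp: image_image)
  have "isomorphic_NRTs G H (conj_by h ` K)"
    using isomorphic_NRTs_conj_by[OF subgroup_conj_by[OF assms(1,3)] _ assms(5), of "inv g"]
      assms cancel subgroup.subset by (metis inv_closed)
  then have "isomorphic_NRTs G (conj_by h ` K) H"
    by (rule isomorphic_NRTs_sym[OF assms(1)])
  then have "isomorphic_NRTs G K H"
    using isomorphic_NRTs_conj_by[OF subgroup_conj_by[OF assms(2,4)], of "inv h" H]
      assms cancel subgroup.subset by (metis inv_closed)
  then show ?thesis by (rule isomorphic_NRTs_sym[OF assms(2)])
qed

text \<open>Equality of the orders turns the inclusion from \<open>sylow_conj\<close> into an
  equality, so the two subgroups are conjugate.\<close>

lemma isomorphic_NRTs_sylow:
  assumes "finite (carrier G)" "prime p" "order G = p ^ n * m" "\<not> p dvd m"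
    and "subgroup H G" "subgroup K G" "card H = p ^ n" "card K = p ^ n"
  shows "isomorphic_NRTs G H K"
proof -
  obtain g where g: "g \<in> carrier G" "conj_by g ` K \<subseteq> H"
    using sylow_conj[OF assms(1-5,7,6,8)] by blast
  have "finite H" using assms(1,5) by (meson finite_subset subgroup.subset)
  moreover have "card (conj_by g ` K) = card H"
    using card_conj_by g(1) assms(6-8) by (simp add: subgroup.subset)
  ultimately have "conj_by g ` K = H" using g(2) by (meson card_subset_eq)
  then show ?thesis
    using isomorphic_NRTs_conj_by[OF assms(6) g(1) isomorphic_NRTs_refl[OF assms(6)]] by simp
qed

end

section \<open>Subgroups of index two\<close>

context group
begin

lemma subgroup_card_dvd:
  assumes "subgroup H G" "subgroup K G" "H \<subseteq> K"
  shows "card H dvd card K"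
proof -
  interpret K: group "G\<lparr>carrier := K\<rparr>" using assms(2) by (rule subgroup_imp_group)
  have "card (rcosets\<^bsub>G\<lparr>carrier := K\<rparr>\<^esub> H) * card H = card K"
    using K.lagrange[OF subgroup_incl[OF assms]] by (simp add: order_def)
  then show ?thesis by (metis dvd_triv_right)
qed

text \<open>\<open>H\<close> and \<open>H #> x\<close> are disjoint subsets of \<open>K\<close> of
  equal size, so together they exhaust it.\<close>

lemma index_two_cosets:
  assumes "finite (carrier G)" "subgroup H G" "subgroup K G" "H \<subseteq> K" "card K = 2 * card H"
    and "x \<in> K" "x \<notin> H"
  shows "K = H \<union> (H #> x)"
proof -
  have fin: "finite K" using assms(1,3) by (meson finite_subset subgroup.subset)
  have x: "x \<in> carrier G" using assms(3,6) by (rule subgroup.mem_carrier)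
  have "y \<notin> H #> x" if y: "y \<in> H" for y
  proof
    have yc: "y \<in> carrier G" using assms(2) y by (rule subgroup.mem_carrier)
    assume "y \<in> H #> x"
    then have "y \<otimes> inv x \<in> H" using mem_rcos_iff[OF assms(2) yc x] by simp
    then have "inv (y \<otimes> inv x) \<otimes> y \<in> H"
      using assms(2) y by (simp add: subgroup.m_closed subgroup.m_inv_closed)
    then show False using assms(7) x yc by (simp add: inv_mult_group m_assoc)
  qed
  then have disj: "H \<inter> (H #> x) = {}" by auto
  have sub: "H #> x \<subseteq> K"
    using assms(3,4,6) by (auto simp: r_coset_def subgroup.m_closed)
  have "card (H #> x) = card H"
    using card_rcosets_equal rcosetsI subgroup.subset[OF assms(2)] x by metis
  then have "card (H \<union> (H #> x)) = card K"
    using disj fin sub assms(4,5) by (simp add: card_Un_disjoint finite_subset)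
  then show ?thesis
    using fin sub assms(4) by (metis Un_least card_subset_eq)
qed

lemma index_two_square:
  assumes "finite (carrier G)" "subgroup H G" "subgroup K G" "H \<subseteq> K" "card K = 2 * card H"
    and "x \<in> K"
  shows "x \<otimes> x \<in> H"
proof (cases "x \<in> H")
  case True
  then show ?thesis using assms(2) by (simp add: subgroup.m_closed)
next
  case False
  have x: "x \<in> carrier G" using assms(3,6) by (rule subgroup.mem_carrier)
  have "x \<otimes> x \<in> H \<union> (H #> x)"
    using index_two_cosets[OF assms False] assms(3,6) by (metis subgroup.m_closed)
  moreover have "x \<otimes> x \<notin> H #> x"
    using False x mem_rcos_iff[OF assms(2), of "x \<otimes> x" x] by (simp add: m_assoc)
  ultimately show ?thesis by blast
qed

text \<open>Normality follows from squares alone, since \<open>conj_by x y\<close> is the product of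
  the square of \<open>x \<otimes> y\<close>, of \<open>inv y\<close>, and of the square of
  \<open>inv x\<close>.\<close>

lemma index_two_conj_by:
  assumes "finite (carrier G)" "subgroup H G" "subgroup K G" "H \<subseteq> K" "card K = 2 * card H"
    and "x \<in> K" "y \<in> H"
  shows "conj_by x y \<in> H"
proof -
  have c: "x \<in> carrier G" "y \<in> carrier G"
    using assms(2,3,6,7) by (simp_all add: subgroup.mem_carrier)
  have "x \<otimes> y \<in> K" "inv x \<in> K"
    using assms(3,4,6,7) by (auto simp: subgroup.m_closed subgroup.m_inv_closed)
  then have "(x \<otimes> y) \<otimes> (x \<otimes> y) \<in> H" "inv x \<otimes> inv x \<in> H" "inv y \<in> H"
    using index_two_square[OF assms(1-5)] assms(2,7) by (simp_all add: subgroup.m_inv_closed)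
  then have "(x \<otimes> y) \<otimes> (x \<otimes> y) \<otimes> inv y \<otimes> (inv x \<otimes> inv x) \<in> H"
    using assms(2) by (simp add: subgroup.m_closed)
  moreover have "(x \<otimes> y) \<otimes> (x \<otimes> y) \<otimes> inv y \<otimes> (inv x \<otimes> inv x) = conj_by x y"
  proof -
    have 1: "y \<otimes> (inv y \<otimes> z) = z" "x \<otimes> (inv x \<otimes> z) = z" if "z \<in> carrier G" for z
      using that c by (simp_all add: m_assoc[symmetric])
    show ?thesis using c by (simp add: conj_by_def m_assoc 1)
  qed
  ultimately show ?thesis by simp
qed

text \<open>The rule \<open>r \<otimes> x = conj_by r x \<otimes> r\<close> moves \<open>r\<close>
  to the right past \<open>P\<close>, and \<open>r \<otimes> r = \<one>\<close> absorbs pairs. The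
  result is the semidirect product of \<open>P\<close> with the group generated by
  \<open>r\<close>.\<close>

lemma subgroup_adjoin_involution:
  assumes "finite (carrier G)" "subgroup P G" "r \<in> carrier G" "r \<notin> P" "r \<otimes> r = \<one>"
    and "\<And>x. x \<in> P \<Longrightarrow> conj_by r x \<in> P"
  shows "subgroup (P \<union> (P #> r)) G" "card (P \<union> (P #> r)) = 2 * card P"
proof -
  interpret P: subgroup P G by fact
  have inv_r: "inv r = r" using assms(3,5) by (simp add: inv_equality)
  have move: "r \<otimes> x = conj_by r x \<otimes> r" if "x \<in> P" for x
    using that assms(3) by (simp add: conj_by_def m_assoc)
  have rr: "r \<otimes> (r \<otimes> x) = x" if "x \<in> carrier G" for x
    using that assms(3,5) by (simp add: m_assoc[symmetric])
  have mult: "x \<otimes> r \<otimes> y = (x \<otimes> conj_by r y) \<otimes> r" if "x \<in> P" "y \<in> P" for x y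
    using that assms(3) by (simp add: m_assoc move)
  have mult2: "x \<otimes> r \<otimes> (y \<otimes> r) = x \<otimes> conj_by r y" if "x \<in> P" "y \<in> P" for x y
  proof -
    have "x \<otimes> r \<otimes> (y \<otimes> r) = (x \<otimes> r \<otimes> y) \<otimes> r"
      using that assms(3) by (simp add: m_assoc)
    also have "\<dots> = x \<otimes> conj_by r y \<otimes> (r \<otimes> r)"
      unfolding mult[OF that] using that assms(3) by (simp add: m_assoc)
    finally show ?thesis using that assms(3,5) by simp
  qed
  have Pr: "P #> r = (\<lambda>x. x \<otimes> r) ` P" by (auto simp: r_coset_def)
  show "subgroup (P \<union> (P #> r)) G"
  proof (rule subgroupI)
    show "P \<union> (P #> r) \<subseteq> carrier G" using P.subset assms(3) by (auto simp: Pr)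
    show "P \<union> (P #> r) \<noteq> {}" using P.one_closed by blast
    fix a assume a: "a \<in> P \<union> (P #> r)"
    show "inv a \<in> P \<union> (P #> r)"
    proof (cases "a \<in> P")
      case False
      then obtain x where x: "x \<in> P" "a = x \<otimes> r" using a by (auto simp: Pr)
      then have "inv a = conj_by r (inv x) \<otimes> r"
        using assms(3) move[of "inv x"] by (simp add: inv_mult_group inv_r)
      then show ?thesis using x(1) assms(6) by (auto simp: Pr)
    qed simp
    fix b assume b: "b \<in> P \<union> (P #> r)"
    show "a \<otimes> b \<in> P \<union> (P #> r)"
    proof (cases "a \<in> P"; cases "b \<in> P")
      assume "a \<in> P" "b \<notin> P"
      then obtain y where y: "y \<in> P" "b = y \<otimes> r" using b by (auto simp: Pr)
      then have "a \<otimes> b = (a \<otimes> y) \<otimes> r" using \<open>a \<in> P\<close> assms(3) by (simp add: m_assoc)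
      then show ?thesis using y(1) \<open>a \<in> P\<close> by (auto simp: Pr)
    next
      assume "a \<notin> P" "b \<in> P"
      then obtain x where x: "x \<in> P" "a = x \<otimes> r" using a by (auto simp: Pr)
      then show ?thesis using mult[OF x(1) \<open>b \<in> P\<close>] assms(6)[OF \<open>b \<in> P\<close>] by (auto simp: Pr)
    next
      assume "a \<notin> P" "b \<notin> P"
      then obtain x y where xy: "x \<in> P" "a = x \<otimes> r" "y \<in> P" "b = y \<otimes> r"
        using a b by (auto simp: Pr)
      then show ?thesis using mult2[OF xy(1,3)] assms(6)[OF xy(3)] by simp
    qed simp
  qed
  have "P \<inter> (P #> r) = {}"
  proof -
    have "r \<in> P" if "x \<in> P" "x \<otimes> r \<in> P" for x
    proof -
      have "inv x \<otimes> (x \<otimes> r) \<in> P" using that by simp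
      then show ?thesis using that(1) assms(3) by (simp add: m_assoc[symmetric])
    qed
    then show ?thesis using assms(4) by (auto simp: Pr)
  qed
  moreover have "card (P #> r) = card P"
    using card_rcosets_equal rcosetsI P.subset assms(3) by metis
  moreover have "finite P" using assms(1) P.subset by (rule finite_subset[rotated])
  ultimately show "card (P \<union> (P #> r)) = 2 * card P"
    by (simp add: card_Un_disjoint Pr)
qed

section \<open>Powers in subgroups of odd or prime order\<close>

lemma subgroup_pow_card:
  assumes "finite (carrier G)" "subgroup H G" "x \<in> H"
  shows "x [^] card H = \<one>"
proof -
  interpret H: group "G\<lparr>carrier := H\<rparr>" using assms(2) by (rule subgroup_imp_group)
  have "x [^]\<^bsub>G\<lparr>carrier := H\<rparr>\<^esub> card H = \<one>"
    using H.pow_order_eq_1[of x] assms by (simp add: order_def)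
  then show ?thesis by (simp add: nat_pow_consistent[symmetric])
qed

text \<open>For \<open>card H = 2 * k + 1\<close> the root is the power of \<open>x\<close> with
  exponent \<open>k + 1\<close>: its square has exponent \<open>card H + 1\<close>.\<close>

lemma odd_subgroup_square_root:
  assumes "finite (carrier G)" "subgroup H G" "odd (card H)" "x \<in> H"
  shows "\<exists>y \<in> H. x = y \<otimes> y"
proof -
  obtain k where k: "card H = 2 * k + 1" using assms(3) by (auto elim: oddE)
  have x: "x \<in> carrier G" using assms(2,4) by (rule subgroup.mem_carrier)
  have "x [^] (k + 1) \<otimes> x [^] (k + 1) = x [^] (k + 1 + (k + 1))"
    using x by (simp only: nat_pow_mult)
  also have "k + 1 + (k + 1) = Suc (card H)" by (simp add: k)
  also have "x [^] Suc (card H) = x [^] card H \<otimes> x" by (simp only: nat_pow_Suc)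
  also have "\<dots> = x" using x subgroup_pow_card[OF assms(1,2,4)] by simp
  finally have eq: "x [^] (k + 1) \<otimes> x [^] (k + 1) = x" .
  interpret H: group "G\<lparr>carrier := H\<rparr>" using assms(2) by (rule subgroup_imp_group)
  have "x [^] (k + 1) \<in> H"
    using H.nat_pow_closed[of x "k + 1"] assms(4) by (simp add: nat_pow_consistent[of x _ H])
  then show ?thesis using eq by metis
qed

lemma odd_subgroup_involution:
  assumes "finite (carrier G)" "subgroup H G" "odd (card H)" "x \<in> H" "x \<otimes> x = \<one>"
  shows "x = \<one>"
proof -
  obtain k where k: "card H = 2 * k + 1" using assms(3) by (auto elim: oddE)
  have x: "x \<in> carrier G" using assms(2,4) by (rule subgroup.mem_carrier)
  have "x [^] (2 * k) = (x [^] (2 :: nat)) [^] k" using x by (simp only: nat_pow_pow)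
  also have "x [^] (2 :: nat) = \<one>" using x assms(5) by (simp add: numeral_2_eq_2)
  finally have "x [^] (2 * k) = \<one>" by simp
  then show ?thesis using subgroup_pow_card[OF assms(1,2,4)] x by (simp add: k)
qed

text \<open>The elements of \<open>P\<close> that \<open>r\<close> conjugates into \<open>P\<close>
  form a subgroup. It contains \<open>x \<noteq> \<one>\<close>, so by primality of
  \<open>card P\<close> it is all of \<open>P\<close>.\<close>

lemma conj_by_closed_prime:
  assumes "subgroup P G" "prime (card P)" "r \<in> carrier G"
    and "x \<in> P" "x \<noteq> \<one>" "conj_by r x \<in> P" "y \<in> P"
  shows "conj_by r y \<in> P"
proof -
  interpret P: subgroup P G by fact
  let ?Q = "P \<inter> conj_by (inv r) ` P"
  have sub: "subgroup ?Q G"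
    using assms(1,3) by (intro subgroups_Inter_pair subgroup_conj_by) simp_all
  have fin: "finite P" using assms(2) by (metis card.infinite not_prime_0)
  have "conj_by (inv r) (conj_by r x) \<in> conj_by (inv r) ` P" using assms(6) by (rule imageI)
  then have "x \<in> ?Q" using assms(3,4) by simp
  then have "card ?Q \<noteq> 1"
    using assms(5) subgroup.one_closed[OF sub] by (metis card_1_singletonE singletonD)
  moreover have "card ?Q dvd card P" using subgroup_card_dvd[OF sub assms(1)] by simp
  ultimately have "card ?Q = card P" using assms(2) by (metis prime_nat_iff)
  then have "?Q = P" using fin by (intro card_subset_eq) simp_all
  then have "y \<in> conj_by (inv r) ` P" using assms(7) by blast
  then show ?thesis using assms(3) by auto
qed

text \<open>Two subgroups of index two share \<open>\<one>\<close>, so they do not cover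
  \<open>G\<close>. An \<open>x\<close> outside both gives the transversal, and since
  \<open>x \<otimes> x\<close> lies in both subgroups, the product of \<open>x\<close> with itself
  is \<open>\<one>\<close> in either loop.\<close>

lemma isomorphic_NRTs_index_two:
  assumes "finite (carrier G)" "subgroup H G" "subgroup K G"
    and "order G = 2 * card H" "order G = 2 * card K"
  shows "isomorphic_NRTs G H K"
proof -
  have sub: "H \<subseteq> carrier G" "K \<subseteq> carrier G" using assms(2,3) by (simp_all add: subgroup.subset)
  then have fin: "finite H" "finite K" using assms(1) finite_subset by blast+
  have one: "\<one> \<in> H" "\<one> \<in> K" using assms(2,3) by (simp_all add: subgroup.one_closed)
  have "card (H \<inter> K) > 0" using one fin by (auto simp: card_gt_0_iff)
  then have "card (H \<union> K) < card (carrier G)"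
    using card_Un_Int[OF fin] assms(4,5) by (simp add: order_def)
  moreover have "H \<union> K \<subseteq> carrier G" using sub by blast
  ultimately obtain x where x: "x \<in> carrier G" "x \<notin> H" "x \<notin> K"
    by (metis Un_iff less_irrefl subsetI subset_antisym)
  then have "x \<noteq> \<one>" using one by blast
  have sq: "x \<otimes> x \<in> H" "x \<otimes> x \<in> K"
    using index_two_square[OF assms(1) _ subgroup_self] sub assms(2-5) x(1)
    by (simp_all add: order_def)
  have NRT: "{\<one>, x} \<in> NRTs G M" if M: "subgroup M G" "x \<notin> M" "order G = 2 * card M" for M
  proof (rule NRTs_finiteI[OF assms(1) M(1)])
    have "inv x \<notin> M" using M(1,2) x(1) by (metis inv_inv subgroup.m_inv_closed)
    then show "y = z" if "y \<in> {\<one>, x}" "z \<in> {\<one>, x}" "y \<otimes> inv z \<in> M" for y z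
      using that M(2) x(1) by auto
  qed (use x(1) \<open>x \<noteq> \<one>\<close> M(3) in auto)
  have "{\<one>, x} \<in> NRTs G H" "{\<one>, x} \<in> NRTs G K"
    using NRT assms(2-5) x(2,3) by simp_all
  then show ?thesis
  proof (rule isomorphic_NRTs_common[OF assms(2,3)])
    show "\<exists>w \<in> {\<one>, x}. w \<otimes> inv (y \<otimes> z) \<in> H \<and> w \<otimes> inv (y \<otimes> z) \<in> K"
      if "y \<in> {\<one>, x}" "z \<in> {\<one>, x}" for y z
      using that one sq x(1) assms(2,3) by (auto simp: subgroup.m_inv_closed)
  qed
qed

end

section \<open>Groups of order \<open>pq\<close>, \<open>4p\<close> and \<open>2pq\<close>\<close>

context group
begin

section \<open>Sylow theory inside a subgroup, and normalizers\<close>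

lemma sylow_subgroup_in:
  assumes "finite (carrier G)" "prime p" "subgroup N G" "card N = p ^ n * m"
  shows "\<exists>P. subgroup P G \<and> P \<subseteq> N \<and> card P = p ^ n"
proof -
  interpret N: group "G\<lparr>carrier := N\<rparr>" using assms(3) by (rule subgroup_imp_group)
  have "finite N" using assms(1,3) by (meson finite_subset subgroup.subset)
  then obtain P where P: "subgroup P (G\<lparr>carrier := N\<rparr>)" "card P = p ^ n"
    using sylow_thm[OF assms(2) N.is_group, of n m] assms(4) by (auto simp: order_def)
  then have "P \<subseteq> N" using subgroup.subset by fastforce
  then show ?thesis using incl_subgroup[OF assms(3) P(1)] P(2) by blast
qed

text \<open>Working in \<open>N\<close> as the ambient group places the conjugating element in
  \<open>N\<close>; this matters when \<open>N\<close> is a normalizer.\<close>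

lemma sylow_conj_in:
  assumes "finite (carrier G)" "prime p" "subgroup N G" "card N = p ^ n * m" "\<not> p dvd m"
    and "subgroup P G" "P \<subseteq> N" "card P = p ^ n" "subgroup K G" "K \<subseteq> N" "card K = p ^ n"
  shows "\<exists>g \<in> N. conj_by g ` K = P"
proof -
  interpret N: group "G\<lparr>carrier := N\<rparr>" using assms(3) by (rule subgroup_imp_group)
  have fin: "finite N" using assms(1,3) by (meson finite_subset subgroup.subset)
  obtain g where g: "g \<in> N" "N.conj_by g ` K \<subseteq> P"
    using N.sylow_conj[of p n m P K n] assms subgroup_incl fin by (auto simp: order_def)
  have gc: "g \<in> carrier G" using assms(3) g(1) by (rule subgroup.mem_carrier)
  have "N.conj_by g x = conj_by g x" for x
    using assms(3) g(1) by (simp add: N.conj_by_def conj_by_def)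
  then have "conj_by g ` K \<subseteq> P" using g(2) by simp
  moreover have "card (conj_by g ` K) = card P"
    using card_conj_by gc assms(8,9,11) by (simp add: subgroup.subset)
  moreover have "finite P" using fin assms(7) by (rule finite_subset[rotated])
  ultimately show ?thesis using g(1) by (meson card_subset_eq)
qed

text \<open>The inclusion suffices to define the normalizer: conjugation preserves the size of the
  finite set \<open>P\<close>, so the inclusion is an equality, which gives closure under
  inverses.\<close>

lemma subgroup_normalizing:
  assumes "finite (carrier G)" "subgroup P G"
  shows "subgroup {g \<in> carrier G. conj_by g ` P \<subseteq> P} G" (is "subgroup ?N G")
proof (rule subgroupI)
  have P: "P \<subseteq> carrier G" using assms(2) by (rule subgroup.subset)
  then have fin: "finite P" using assms(1) by (rule finite_subset)
  have "conj_by \<one> ` P \<subseteq> P" using P by auto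
  then show "?N \<noteq> {}" by blast
  fix a assume a: "a \<in> ?N"
  then have "conj_by a ` P = P"
    using card_conj_by[OF P, of a] by (intro card_subset_eq[OF fin]) simp_all
  then have "conj_by (inv a) ` P = conj_by (inv a) ` conj_by a ` P" by simp
  also have "\<dots> = conj_by \<one> ` P" using a P by (simp add: image_conj_by_conj_by)
  also have "\<dots> \<subseteq> P" using P by auto
  finally show "inv a \<in> ?N" using a by simp
  fix b assume b: "b \<in> ?N"
  then have "conj_by (a \<otimes> b) ` P = conj_by a ` conj_by b ` P"
    using a P by (simp add: image_conj_by_conj_by)
  also have "\<dots> \<subseteq> P" using a b by blast
  finally show "a \<otimes> b \<in> ?N" using a b by simp
qed auto

text \<open>The conditions on \<open>m\<close> make subgroups of order \<open>p\<close> and of order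
  2 Sylow subgroups. Conjugacy is used once for each prime, the second time in the normalizer of
  \<open>P\<close>, and shows that \<open>H\<close> and \<open>K\<close> are themselves
  conjugate.\<close>

lemma isomorphic_NRTs_twice_prime:
  assumes "finite (carrier G)" "prime p" "odd p" "order G = 2 * p * m" "odd m" "\<not> p dvd m"
    and "subgroup H G" "subgroup K G" "card H = 2 * p" "card K = 2 * p"
  shows "isomorphic_NRTs G H K"
proof -
  have p2: "\<not> p dvd 2 * m"
    using assms(2,3,6) primes_dvd_imp_eq[OF assms(2) two_is_prime_nat]
    by (auto simp: prime_dvd_mult_iff)
  obtain P where P: "subgroup P G" "P \<subseteq> H" "card P = p"
    using sylow_subgroup_in[OF assms(1,2,7), of 1 2] assms(9) by auto
  obtain Q where Q: "subgroup Q G" "Q \<subseteq> K" "card Q = p"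
    using sylow_subgroup_in[OF assms(1,2,8), of 1 2] assms(10) by auto
  obtain g where g: "g \<in> carrier G" "conj_by g ` Q = P"
    using sylow_conj_in[OF assms(1,2) subgroup_self _ p2, of 1 P Q] P Q assms(4)
    by (auto simp: order_def subgroup.subset)
  \<comment> \<open>After this conjugation \<open>H\<close> and \<open>L\<close> both contain
    \<open>P\<close> with index two, so both lie in the normalizer \<open>N\<close> of
    \<open>P\<close>.\<close>
  define L where "L = conj_by g ` K"
  have L: "subgroup L G" "P \<subseteq> L" "card L = 2 * p"
    using subgroup_conj_by[OF assms(8) g(1)] g(2) Q(2) assms(8,10) card_conj_by g(1)
    by (auto simp: L_def subgroup.subset)
  define N where "N = {x \<in> carrier G. conj_by x ` P \<subseteq> P}"
  have N: "subgroup N G" unfolding N_def by (rule subgroup_normalizing[OF assms(1) P(1)])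
  have index2: "M \<subseteq> N" if "subgroup M G" "P \<subseteq> M" "card M = 2 * p" for M
    using index_two_conj_by[OF assms(1) P(1) that(1,2)] P(3) that
    by (auto simp: N_def subgroup.mem_carrier)
  have HN: "H \<subseteq> N" and LN: "L \<subseteq> N" using index2 assms(7,9) P(2) L by simp_all
  have "2 * p dvd card N" using subgroup_card_dvd[OF assms(7) N HN] assms(9) by simp
  then obtain k where "card N = 2 * p * k" by (rule dvdE)
  then have k: "card N = 2 ^ 1 * (p * k)" by simp
  have "card N dvd order G"
    using subgroup_card_dvd[OF N subgroup_self] N by (simp add: order_def subgroup.subset)
  then have "k dvd m" using k assms(2,4) by (simp add: mult.assoc prime_gt_0_nat)
  \<comment> \<open>Since 2 divides \<open>card N\<close> only once, subgroups of order two in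
    \<open>N\<close> are Sylow subgroups. Conjugating them by an element of \<open>N\<close> keeps
    \<open>P\<close> in place.\<close>
  then have "\<not> 2 dvd p * k" using assms(3,5) by auto
  obtain A where A: "subgroup A G" "A \<subseteq> H" "card A = 2 ^ 1"
    using sylow_subgroup_in[OF assms(1) two_is_prime_nat assms(7), of 1 p] assms(9) by auto
  obtain B where B: "subgroup B G" "B \<subseteq> L" "card B = 2 ^ 1"
    using sylow_subgroup_in[OF assms(1) two_is_prime_nat L(1), of 1 p] L(3) by auto
  obtain h where h: "h \<in> N" "conj_by h ` B = A"
    using sylow_conj_in[OF assms(1) two_is_prime_nat N k \<open>\<not> 2 dvd p * k\<close> A(1) _ A(3) B(1) _ B(3)]
      A(2) B(2) HN LN by blast
  have hc: "h \<in> carrier G" using N h(1) by (rule subgroup.mem_carrier)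
  have fin: "finite P" using assms(1) P(1) by (meson finite_subset subgroup.subset)
  have hP: "conj_by h ` P = P"
    using h(1) hc fin card_conj_by[OF subgroup.subset[OF P(1)] hc] by (auto simp: N_def card_subset_eq)
  have sub: "subgroup (conj_by h ` L) G" by (rule subgroup_conj_by[OF L(1) hc])
  have "\<not> A \<subseteq> P"
    using subgroup_card_dvd[OF A(1) P(1)] A(3) P(3) assms(3) by auto
  then obtain a where a: "a \<in> A" "a \<notin> P" by blast
  \<comment> \<open>\<open>H\<close> is built from \<open>P\<close> and \<open>a\<close> alone, so
    it is enough that the conjugate of \<open>L\<close> contains these two.\<close>
  have "H = P \<union> (P #> a)"
    using index_two_cosets[OF assms(1) P(1) assms(7) P(2)] P(3) A(2) a assms(9) by auto
  moreover have "P \<subseteq> conj_by h ` L" using hP L(2) by blast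
  moreover have "a \<in> conj_by h ` L" using h(2) a(1) B(2) by blast
  ultimately have "H \<subseteq> conj_by h ` L"
    using sub by (auto simp: r_coset_def subgroup.m_closed)
  moreover have cardL: "card (conj_by h ` L) = card H"
    using card_conj_by[OF subgroup.subset[OF L(1)] hc] L(3) assms(9) by simp
  moreover have "finite (conj_by h ` L)"
    using sub assms(1) by (meson finite_subset subgroup.subset)
  ultimately have "H = conj_by h ` L" by (intro card_subset_eq) simp_all
  then show ?thesis
    using isomorphic_NRTs_conj_by_cancel[OF assms(7,8) one_closed, of "h \<otimes> g"]
      isomorphic_NRTs_refl[OF assms(7)] image_conj_by_conj_by[of \<one> h L]
      image_conj_by_conj_by[OF hc g(1) subgroup.subset[OF assms(8)]] hc g(1) L(1)
    by (simp add: L_def subgroup.subset)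
qed

text \<open>Every element of \<open>P\<close> is a fourth power, and squaring twice leads from \<open>G\<close> through \<open>M\<close> into \<open>P\<close>.\<close>

lemma normal_of_index_four:
  assumes "finite (carrier G)" "subgroup P G" "subgroup M G" "P \<subseteq> M" "odd (card P)"
    and "card M = 2 * card P" "order G = 2 * card M" "g \<in> carrier G" "x \<in> P"
  shows "conj_by g x \<in> P"
proof -
  have P: "y \<in> carrier G" if "y \<in> P" for y using assms(2) that by (rule subgroup.mem_carrier)
  have M: "M \<subseteq> carrier G" using assms(3) by (rule subgroup.subset)
  obtain y where y: "y \<in> P" "x = y \<otimes> y"
    using odd_subgroup_square_root[OF assms(1,2,5,9)] by blast
  obtain z where z: "z \<in> P" "y = z \<otimes> z"
    using odd_subgroup_square_root[OF assms(1,2,5) y(1)] by blast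
  have "conj_by g z \<otimes> conj_by g z \<in> M"
    using index_two_square[OF assms(1,3) subgroup_self M] assms(7,8) P z(1) by (simp add: order_def)
  then have "conj_by g y \<in> M" using assms(8) P z by (simp add: conj_by_mult)
  then have "conj_by g y \<otimes> conj_by g y \<in> P"
    by (rule index_two_square[OF assms(1,2,3,4,6)])
  then show ?thesis using assms(8) P y by (simp add: conj_by_mult)
qed

lemma isomorphic_NRTs_klein_four:
  assumes "finite (carrier G)" "prime p" "odd p" "order G = 4 * p"
    and "subgroup T G" "card T = 4" "a \<in> T" "b \<in> T" "a \<noteq> \<one>" "b \<noteq> \<one>" "a \<noteq> b"
    and "a \<otimes> a = \<one>" "b \<otimes> b = \<one>" "subgroup {\<one>, a} G" "subgroup {\<one>, b} G"
  shows "isomorphic_NRTs G {\<one>, a} {\<one>, b}"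
proof -
  interpret T: subgroup T G by fact
  have c: "a \<in> carrier G" "b \<in> carrier G" using assms(7,8) by simp_all
  have aa: "a \<otimes> (a \<otimes> x) = x" "b \<otimes> (b \<otimes> x) = x" if "x \<in> carrier G" for x
    using that c assms(12,13) by (simp_all add: m_assoc[symmetric])
  have "a \<otimes> b \<noteq> \<one>" "b \<otimes> a \<noteq> \<one>"
    using aa(1)[OF c(2)] aa(2)[OF c(1)] c assms(11) by auto
  then have ab: "a \<otimes> b \<noteq> \<one>" "a \<otimes> b \<noteq> a" "a \<otimes> b \<noteq> b" "b \<otimes> a \<noteq> \<one>" "b \<otimes> a \<noteq> a" "b \<otimes> a \<noteq> b"
    using c assms(9,10) by simp_all
  have "card {\<one>, a, b, a \<otimes> b} = card T" using assms(6,9-11) ab by simp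
  moreover have "{\<one>, a, b, a \<otimes> b} \<subseteq> T" using assms(7,8) by simp
  moreover have "finite T" using assms(6) by (metis card.infinite zero_neq_numeral)
  ultimately have "T = {\<one>, a, b, a \<otimes> b}" by (metis card_subset_eq)
  then have T_cases: "t = \<one> \<or> t = a \<or> t = b \<or> t = a \<otimes> b" if "t \<in> T" for t
    using that by blast
  \<comment> \<open>Both products differ from \<open>\<one>\<close>, \<open>a\<close> and
    \<open>b\<close>, and \<open>T\<close> has only one further element.\<close>
  have comm: "b \<otimes> a = a \<otimes> b" using T_cases[of "b \<otimes> a"] assms(7,8) ab by blast
  have "(a \<otimes> b) \<otimes> (a \<otimes> b) = a \<otimes> (b \<otimes> a) \<otimes> b" using c by (simp add: m_assoc)
  also have "\<dots> = \<one>" unfolding comm using c assms(12,13) aa by (simp add: m_assoc)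
  finally have ab_sq: "(a \<otimes> b) \<otimes> (a \<otimes> b) = \<one>" .
  have T_sq: "t \<otimes> t = \<one>" if "t \<in> T" for t
    using T_cases[OF that] assms(12,13) ab_sq by (elim disjE) simp_all
  obtain P where P: "subgroup P G" "card P = p"
    using sylow_thm[OF assms(2) is_group, of 1 4] assms(1,4) by (auto simp: mult.commute)
  interpret P: subgroup P G by fact
  have oddP: "odd (card P)" using assms(3) P(2) by simp
  have finP: "finite P" using assms(1) P.subset by (rule finite_subset[rotated])
  have notP: "t \<notin> P" if "t \<in> T" "t \<noteq> \<one>" for t
    using odd_subgroup_involution[OF assms(1) P(1) oddP] T_sq that by blast
  show ?thesis
  proof (cases "\<exists>r \<in> T. r \<noteq> \<one> \<and> (\<forall>x \<in> P. conj_by r x \<in> P)")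
    case True
    then obtain r where r: "r \<in> T" "r \<noteq> \<one>" "\<And>x. x \<in> P \<Longrightarrow> conj_by r x \<in> P" by blast
    \<comment> \<open>\<open>M\<close> lies between \<open>P\<close> and \<open>G\<close> with both
      indices two, so \<open>normal_of_index_four\<close> makes \<open>P\<close> normal.\<close>
    define M where "M = P \<union> (P #> r)"
    have M: "subgroup M G" "card M = 2 * card P"
      using subgroup_adjoin_involution[OF assms(1) P(1) _ notP T_sq r(3)] r(1,2)
      by (simp_all add: M_def)
    have normal: "conj_by g x \<in> P" if "g \<in> carrier G" "x \<in> P" for g x
      using normal_of_index_four[OF assms(1) P(1) M(1) _ oddP M(2) _ that] M(2) P(2) assms(4)
      by (simp add: M_def)
    \<comment> \<open>As \<open>P\<close> is now normal, \<open>a \<otimes> b\<close> can be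
      adjoined too. If \<open>L\<close> contained \<open>a\<close> or \<open>b\<close>, multiplying
      by \<open>a \<otimes> b\<close> would put the other one into \<open>P\<close>, which has odd
      order.\<close>
    define L where "L = P \<union> (P #> (a \<otimes> b))"
    have abT: "a \<otimes> b \<in> T" using assms(7,8) by simp
    then have L: "subgroup L G" "card L = 2 * card P"
      using subgroup_adjoin_involution[OF assms(1) P(1) _ notP T_sq normal] ab(1)
      by (simp_all add: L_def)
    have notL: "t \<notin> L" if t: "t \<in> {a, b}" for t
    proof
      assume "t \<in> L"
      moreover have "t \<notin> P" using t notP assms(7-10) by blast
      ultimately have "t \<in> P #> (a \<otimes> b)" by (simp add: L_def)
      then have "t \<otimes> inv (a \<otimes> b) \<in> P" using mem_rcos_iff[OF P(1)] t c by auto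
      moreover have "t \<otimes> inv (a \<otimes> b) = a \<or> t \<otimes> inv (a \<otimes> b) = b"
      proof -
        have "inv (a \<otimes> b) = a \<otimes> b" using ab_sq c by (simp add: inv_equality)
        moreover have "a \<otimes> (a \<otimes> b) = b" using aa(1) c by simp
        moreover have "b \<otimes> (a \<otimes> b) = a" unfolding comm[symmetric] using aa(2) c by simp
        ultimately show ?thesis using t by auto
      qed
      moreover have "a \<notin> P" "b \<notin> P" using notP assms(7-10) by simp_all
      ultimately show False by (elim disjE) simp_all
    qed
    show ?thesis
    proof (rule isomorphic_NRTs_complement[OF assms(1,14,15) L(1)])
      show "L \<inter> {\<one>, a} = {\<one>}" "L \<inter> {\<one>, b} = {\<one>}"
        using notL subgroup.one_closed[OF L(1)] by auto
      show "card L * card {\<one>, a} = order G" "card L * card {\<one>, b} = order G"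
        using L(2) P(2) assms(4,9,10) by simp_all
    qed
  next
    case False
    \<comment> \<open>By primality of \<open>card P\<close>, carrying one nontrivial element of
      \<open>P\<close> into \<open>P\<close> already means normalizing \<open>P\<close>, which is
      excluded here for nontrivial \<open>r\<close>.\<close>
    have fix_imp_one: "r = \<one>" if "r \<in> T" "x \<in> P" "x \<noteq> \<one>" "conj_by r x \<in> P" for r x
      using False conj_by_closed_prime[OF P(1) _ _ that(2-4)] that(1) assms(2) P(2) by auto
    \<comment> \<open>These are the nontrivial elements of the conjugates of \<open>P\<close> by
      \<open>T\<close>. Indexing by pairs lets one injectivity statement give both the disjointness
      of the conjugates and the count.\<close>
    define E where "E = (\<lambda>(t, x). conj_by t x) ` (T \<times> (P - {\<one>}))"
    have inj: "inj_on (\<lambda>(t, x). conj_by t x) (T \<times> (P - {\<one>}))"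
    proof (rule inj_onI)
      fix u v
      assume uv: "u \<in> T \<times> (P - {\<one>})" "v \<in> T \<times> (P - {\<one>})"
        and "(\<lambda>(t, x). conj_by t x) u = (\<lambda>(t, x). conj_by t x) v"
      moreover obtain s x t y where stxy: "u = (s, x)" "v = (t, y)" by (metis surj_pair)
      ultimately have eq: "conj_by s x = conj_by t y" and st: "s \<in> T" "t \<in> T"
        and xy: "x \<in> P" "y \<in> P" "x \<noteq> \<one>" "y \<noteq> \<one>"
        by simp_all
      have "conj_by (inv t \<otimes> s) x = conj_by (inv t) (conj_by s x)"
        using st xy by (simp add: conj_by_conj_by)
      also have "\<dots> = y" using eq st xy by simp
      finally have "inv t \<otimes> s = \<one>"
        using fix_imp_one[of "inv t \<otimes> s" x] st xy by simp
      then have "inv s = inv t" using st inv_equality[of "inv t" s] by simp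
      then have "s = t" using st by (metis T.mem_carrier inv_inv)
      then show "u = v" using eq st xy by (simp add: stxy)
    qed
    have cardE: "card E = 4 * (p - 1)"
      unfolding E_def card_image[OF inj] using assms(6) P(2) finP by (simp add: card_cartesian_product)
    have E_sub: "E \<subseteq> carrier G" by (auto simp: E_def)
    \<comment> \<open>Each \<open>u\<close> is conjugate to a nontrivial element of
      \<open>P\<close>, and in odd order such an element cannot square to
      \<open>\<one>\<close>.\<close>
    have no_inv: "u \<noteq> \<one>" "u \<otimes> u \<noteq> \<one>" if "u \<in> E" for u
    proof -
      obtain t x where tx: "t \<in> T" "x \<in> P" "x \<noteq> \<one>" "u = conj_by t x"
        using \<open>u \<in> E\<close> by (auto simp: E_def)
      show "u \<otimes> u \<noteq> \<one>"
      proof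
        assume "u \<otimes> u = \<one>"
        then have "conj_by t (x \<otimes> x) = conj_by t \<one>" using tx by (simp add: conj_by_mult)
        then have "x \<otimes> x = \<one>" using tx by (subst (asm) conj_by_inj_iff) auto
        then show False using odd_subgroup_involution[OF assms(1) P(1) oddP] tx by blast
      qed
      then show "u \<noteq> \<one>" by auto
    qed
    \<comment> \<open>What is left has \<open>4 * p - (4 * (p - 1) + 1) = 3\<close>
      elements.\<close>
    define R where "R = carrier G - insert \<one> E"
    have finR: "finite R" using assms(1) by (simp add: R_def)
    have "card (insert \<one> E) = 4 * (p - 1) + 1"
      using no_inv(1) cardE assms(1) E_sub by (subst card_insert_disjoint) (auto intro: finite_subset)
    then have cardR: "card R = 3"
      using assms(1,2,4) E_sub prime_gt_1_nat[OF assms(2)]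
      by (simp add: R_def order_def card_Diff_subset finite_subset)
    \<comment> \<open>The conjugates of the involution \<open>t\<close> by \<open>P\<close> are
      involutions, hence lie in \<open>R\<close>. They are \<open>p\<close> in number, and
      \<open>p \<ge> 3 = card R\<close>, so they fill \<open>R\<close>.\<close>
    have R_conj: "R = (\<lambda>x. conj_by x t) ` P" if t: "t \<in> T" "t \<noteq> \<one>" for t
    proof -
      have "inj_on (\<lambda>x. conj_by x t) P"
      proof (rule inj_onI)
        fix x y assume xy: "x \<in> P" "y \<in> P" and eq: "conj_by x t = conj_by y t"
        \<comment> \<open>Equal conjugates make \<open>z\<close> commute with \<open>t\<close>. Then
          \<open>t\<close> fixes an element of \<open>P\<close>, which \<open>fix_imp_one\<close>
          allows only for \<open>z = \<one>\<close>.\<close>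
        define z where "z = inv y \<otimes> x"
        have z: "z \<in> P" using xy by (simp add: z_def)
        have "conj_by z t = conj_by (inv y) (conj_by x t)"
          using xy t by (simp add: z_def conj_by_conj_by)
        also have "\<dots> = t" using eq xy t by simp
        finally have "z \<otimes> t = t \<otimes> z"
          using z t by (simp add: conj_by_def inv_solve_right')
        then have "conj_by t z = z" using z t by (simp add: conj_by_def inv_solve_right')
        then have "z = \<one>" using fix_imp_one[of t z] z t by auto
        then have "inv x = inv y" using xy inv_equality[of "inv y" x] by (simp add: z_def)
        then show "x = y" using xy by (metis P.mem_carrier inv_inv)
      qed
      then have "card ((\<lambda>x. conj_by x t) ` P) = p" using P(2) by (simp add: card_image)
      moreover have sub: "(\<lambda>x. conj_by x t) ` P \<subseteq> R"
      proof
        fix u assume "u \<in> (\<lambda>x. conj_by x t) ` P"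
        then obtain x where x: "x \<in> P" "u = conj_by x t" by blast
        have "u \<otimes> u = conj_by x (t \<otimes> t)" using x t by (simp add: conj_by_mult)
        then have "u \<otimes> u = \<one>" using x t T_sq by simp
        moreover have "u \<noteq> \<one>" using x t conj_by_inj_iff[of x t \<one>] by simp
        ultimately show "u \<in> R" using no_inv(2) x t by (auto simp: R_def)
      qed
      \<comment> \<open>This forces \<open>p = 3\<close>.\<close>
      moreover have "p \<ge> 3" using assms(2,3) prime_ge_2_nat[OF assms(2)] by (cases "p = 2") auto
      ultimately show ?thesis using card_seteq[OF finR sub] cardR by simp
    qed
    \<comment> \<open>\<open>b\<close> is its own conjugate by \<open>\<one>\<close>, so it lies in
      \<open>R\<close>, which is also the set of conjugates of \<open>a\<close>.\<close>
    have "conj_by \<one> b \<in> R"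
      unfolding R_conj[OF assms(8,10)] using P.one_closed by (rule imageI)
    then have "b \<in> (\<lambda>x. conj_by x a) ` P" using c(2) R_conj[OF assms(7,9)] by simp
    then obtain x where x: "b = conj_by x a" "x \<in> P" by (rule imageE)
    have "conj_by x ` {\<one>, a} = {\<one>, b}" using x by simp
    then show ?thesis
      using isomorphic_NRTs_conj_by[OF assms(14) _ isomorphic_NRTs_refl[OF assms(14)], of x]
        isomorphic_NRTs_sym[OF assms(15)] x(2) by simp
  qed
qed

section \<open>Subgroups of order two in a group of order \<open>4 * p\<close>\<close>

lemma subgroup_card_two:
  assumes "subgroup H G" "card H = 2"
  obtains a where "H = {\<one>, a}" "a \<noteq> \<one>" "a \<otimes> a = \<one>"
proof -
  interpret H: subgroup H G by fact
  obtain x y where "H = {x, y}" "x \<noteq> y" using assms(2) by (auto simp: card_2_iff)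
  then obtain a where a: "H = {\<one>, a}" "a \<noteq> \<one>" using H.one_closed by fastforce
  have "a \<in> carrier G" "a \<otimes> a \<in> H" using a(1) H.m_closed H.mem_carrier by blast+
  then have "a \<otimes> a = \<one>" using a by auto
  then show ?thesis using a that by blast
qed

lemma isomorphic_NRTs_order_two:
  assumes "finite (carrier G)" "prime p" "odd p" "order G = 4 * p"
    and "subgroup H G" "subgroup K G" "card H = 2" "card K = 2"
  shows "isomorphic_NRTs G H K"
proof -
  have ord: "order G = 2 ^ 2 * p" using assms(4) by simp
  obtain T where T: "subgroup T G" "card T = 2 ^ 2"
    using sylow_thm[OF two_is_prime_nat is_group ord assms(1)] by blast
  \<comment> \<open>\<open>sylow_conj\<close> applies to every 2-subgroup, not only to Sylow ones,
    so \<open>H\<close> and \<open>K\<close> can each be moved into the same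
    \<open>T\<close>.\<close>
  note conjT = sylow_conj[OF assms(1) two_is_prime_nat ord assms(3) T]
  obtain g where g: "g \<in> carrier G" "conj_by g ` H \<subseteq> T"
    using conjT[OF assms(5), of 1] assms(7) by auto
  obtain h where h: "h \<in> carrier G" "conj_by h ` K \<subseteq> T"
    using conjT[OF assms(6), of 1] assms(8) by auto
  have H: "subgroup (conj_by g ` H) G" "card (conj_by g ` H) = 2"
    using subgroup_conj_by[OF assms(5) g(1)] card_conj_by[OF subgroup.subset[OF assms(5)] g(1)] assms(7)
    by simp_all
  have K: "subgroup (conj_by h ` K) G" "card (conj_by h ` K) = 2"
    using subgroup_conj_by[OF assms(6) h(1)] card_conj_by[OF subgroup.subset[OF assms(6)] h(1)] assms(8)
    by simp_all
  obtain a where a: "conj_by g ` H = {\<one>, a}" "a \<noteq> \<one>" "a \<otimes> a = \<one>"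
    by (rule subgroup_card_two[OF H])
  obtain b where b: "conj_by h ` K = {\<one>, b}" "b \<noteq> \<one>" "b \<otimes> b = \<one>"
    by (rule subgroup_card_two[OF K])
  have "isomorphic_NRTs G (conj_by g ` H) (conj_by h ` K)"
  proof (cases "a = b")
    case True
    then show ?thesis using isomorphic_NRTs_refl[OF H(1)] a(1) b(1) by simp
  next
    case False
    show ?thesis
      unfolding a(1) b(1)
      by (rule isomorphic_NRTs_klein_four[OF assms(1-4) T(1)])
        (use False T(2) H(1) K(1) a b g(2) h(2) in simp_all)
  qed
  then show ?thesis by (rule isomorphic_NRTs_conj_by_cancel[OF assms(5,6) g(1) h(1)])
qed

section \<open>Extreme orders and the enumeration of divisors\<close>

lemma isomorphic_NRTs_trivial:
  assumes "finite (carrier G)" "subgroup H G" "subgroup K G"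
    and "card H = card K" "card H = 1 \<or> card H = order G"
  shows "isomorphic_NRTs G H K"
proof -
  have "M = {\<one>}" if "subgroup M G" "card M = 1" for M
    using that subgroup.one_closed by (metis card_1_singletonE singletonD)
  moreover have "M = carrier G" if "subgroup M G" "card M = order G" for M
    using that assms(1) by (simp add: card_subset_eq order_def subgroup.subset)
  ultimately have "H = K" using assms(2-5) by metis
  then show ?thesis using isomorphic_NRTs_refl[OF assms(2)] by simp
qed

end

text \<open>Either \<open>p\<close> divides \<open>d\<close> and cancels, or \<open>d\<close> is
  coprime to \<open>p\<close>. Splitting off one prime at a time lists the possible subgroup
  orders.\<close>

lemma dvd_prime_mult_cases:
  fixes p d m :: nat
  assumes "prime p" "d dvd p * m"
  shows "d dvd m \<or> (\<exists>e. e dvd m \<and> d = p * e)"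
proof (cases "p dvd d")
  case True
  then show ?thesis using assms by (auto simp: dvd_def prime_gt_0_nat)
next
  case False
  then have "coprime d p" using prime_imp_coprime[OF assms(1)] by (simp add: coprime_commute)
  then show ?thesis using assms(2) by (simp add: coprime_dvd_mult_right_iff)
qed

theorem proposition3p5:
  fixes p q :: nat and G :: "('a, 'b) monoid_scheme"
  assumes "prime p" "prime q" "odd p" "odd q" "p \<noteq> q"
    and "group G"
    and "order G = p * q \<or> order G = 4 * p \<or> order G = 2 * p * q"
  shows "t_group G"
proof -
  interpret group G by fact
  have pos: "p > 0" "q > 0" using assms(1,2) by (simp_all add: prime_gt_0_nat)
  \<comment> \<open>An infinite carrier would have \<open>order G = 0\<close>, so the given order
    yields finiteness.\<close>
  then have "order G > 0" using assms(7) by auto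
  then have fin: "finite (carrier G)" by (simp add: order_gt_0_iff_finite)
  have ndvd: "\<not> p dvd q" "\<not> q dvd p" "\<not> p dvd 2" "\<not> q dvd 2"
    using assms(1-5) by (auto dest: primes_dvd_imp_eq[OF _ two_is_prime_nat] primes_dvd_imp_eq)
  then have ndvd': "\<not> p dvd 2 * q" "\<not> q dvd 2 * p" "\<not> p dvd 4"
    using assms(1,2) by (auto simp: prime_dvd_mult_iff dest: prime_dvd_power[of p 2 2])
  have prime_cases: "d = 1 \<or> d = r" if "prime r" "d dvd r" for d r :: nat
    using that by (auto simp: prime_nat_iff)
  have "isomorphic_NRTs G H K"
    if d: "d dvd order G" and H: "subgroup H G" "card H = d" and K: "subgroup K G" "card K = d"
    for d H K
  proof -
    note sylow = isomorphic_NRTs_sylow[OF fin _ _ _ H(1) K(1)]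
    note triv = isomorphic_NRTs_trivial[OF fin H(1) K(1)]
    note half = isomorphic_NRTs_index_two[OF fin H(1) K(1)]
    consider "order G = p * q" | "order G = 4 * p" | "order G = 2 * p * q" using assms(7) by blast
    then show ?thesis
    proof cases
      case 1
      then have "d dvd q \<or> (\<exists>e. e dvd q \<and> d = p * e)"
        using dvd_prime_mult_cases[OF assms(1)] d by simp
      then have "d = 1 \<or> d = q \<or> d = p \<or> d = p * q"
        using prime_cases[OF assms(2)] by (elim disjE exE conjE) fastforce+
      then consider "d = 1 \<or> d = order G" | "d = p" | "d = q" unfolding 1 by blast
      then show ?thesis
      proof cases
        case 1 then show ?thesis using triv H(2) K(2) by simp
      next
        case 2 then show ?thesis
          using sylow[OF assms(1), of 1 q] H(2) K(2) \<open>order G = p * q\<close> ndvd by simp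
      next
        case 3 then show ?thesis
          using sylow[OF assms(2), of 1 p] H(2) K(2) \<open>order G = p * q\<close> ndvd by (simp add: mult.commute)
      qed
    next
      case 2
      \<comment> \<open>The cofactor 4 is not prime, so its divisors are found by bounding them and
        excluding 0 and 3.\<close>
      have four: "e = 1 \<or> e = 2 \<or> e = 4" if "e dvd 4" for e :: nat
      proof -
        have "e \<le> 4" using dvd_imp_le[OF that] by simp
        moreover have "e \<noteq> 0" using that by (cases "e = 0") simp_all
        moreover have "e \<noteq> 3" using that by (cases "e = 3") simp_all
        ultimately show ?thesis by linarith
      qed
      have "d dvd 4 \<or> (\<exists>e. e dvd 4 \<and> d = p * e)"
        using dvd_prime_mult_cases[OF assms(1), of d 4] d 2 by (simp add: mult.commute)
      then have "d = 1 \<or> d = 2 \<or> d = 4 \<or> d = p \<or> d = 2 * p \<or> d = 4 * p"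
        using four by (elim disjE exE conjE) fastforce+
      then consider "d = 1 \<or> d = order G" | "d = 2" | "d = 4" | "d = p" | "d = 2 * p"
        unfolding 2 by blast
      then show ?thesis
      proof cases
        case 1 then show ?thesis using triv H(2) K(2) by simp
      next
        case 2 then show ?thesis
          using isomorphic_NRTs_order_two[OF fin assms(1,3) \<open>order G = 4 * p\<close> H(1) K(1)] H(2) K(2) by simp
      next
        case 3 then show ?thesis
          using sylow[OF two_is_prime_nat, of 2 p] H(2) K(2) \<open>order G = 4 * p\<close> assms(3) by simp
      next
        case 4 then show ?thesis
          using sylow[OF assms(1), of 1 4] H(2) K(2) \<open>order G = 4 * p\<close> ndvd' by simp
      next
        case 5 then show ?thesis using half H(2) K(2) \<open>order G = 4 * p\<close> by simp
      qed
    next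
      case 3
      \<comment> \<open>Of the proper nontrivial orders, \<open>2\<close>, \<open>p\<close> and
        \<open>q\<close> are Sylow orders, \<open>2 * p\<close> and \<open>2 * q\<close> are twice
        an odd prime, and \<open>p * q\<close> has index two.\<close>
      have "d dvd 2 * q \<or> (\<exists>e. e dvd 2 * q \<and> d = p * e)"
        using dvd_prime_mult_cases[OF assms(1), of d "2 * q"] d 3 by (simp add: ac_simps)
      moreover have "e = 1 \<or> e = 2 \<or> e = q \<or> e = 2 * q" if "e dvd 2 * q" for e
      proof -
        have "e dvd 2 \<or> (\<exists>f. f dvd 2 \<and> e = q * f)"
          using dvd_prime_mult_cases[OF assms(2), of e 2] that by (simp add: mult.commute)
        then show ?thesis
          using prime_cases[OF two_is_prime_nat] by (elim disjE exE conjE) fastforce+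
      qed
      ultimately have "d = 1 \<or> d = 2 \<or> d = q \<or> d = 2 * q
          \<or> d = p \<or> d = 2 * p \<or> d = p * q \<or> d = 2 * p * q"
        by (elim disjE exE conjE) fastforce+
      then consider "d = 1 \<or> d = order G" | "d = 2" | "d = p" | "d = q"
        | "d = 2 * p" | "d = 2 * q" | "d = p * q"
        unfolding 3 by blast
      then show ?thesis
      proof cases
        case 1 then show ?thesis using triv H(2) K(2) by simp
      next
        case 2 then show ?thesis
          using sylow[OF two_is_prime_nat, of 1 "p * q"] H(2) K(2) \<open>order G = 2 * p * q\<close> assms(3,4) by simp
      next
        case 3 then show ?thesis
          using sylow[OF assms(1), of 1 "2 * q"] H(2) K(2) \<open>order G = 2 * p * q\<close> ndvd' by simp
      next
        case 4 then show ?thesis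
          using sylow[OF assms(2), of 1 "2 * p"] H(2) K(2) \<open>order G = 2 * p * q\<close> ndvd' by simp
      next
        case 5 then show ?thesis
          using isomorphic_NRTs_twice_prime[OF fin assms(1,3) \<open>order G = 2 * p * q\<close> assms(4) ndvd(1) H(1) K(1)]
            H(2) K(2) by simp
      next
        case 6
        \<comment> \<open>The roles of \<open>p\<close> and \<open>q\<close> are exchanged, so the
          order is rewritten to match.\<close>
        have "order G = 2 * q * p" using \<open>order G = 2 * p * q\<close> by simp
        then show ?thesis
          using isomorphic_NRTs_twice_prime[OF fin assms(2,4) _ assms(3) ndvd(2) H(1) K(1)] 6
            H(2) K(2) by simp
      next
        case 7 then show ?thesis using half H(2) K(2) \<open>order G = 2 * p * q\<close> by simp
      qed
    qed
  qed
  then show ?thesis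
    using t_group_iff_adjacent[OF assms(6) fin] unfolding isomorphic_NRTs_def by blast
qed

end
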